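(* Let $p\in(0,1)$ and let $(\zeta_t^{O}: t=0,1,2,\dots)$ be the standard specifications randomly fluctuating intervals process on $\mathbb{Z}$ with expansion parameter $p$, started from $\zeta_0^{O}=\{0\}$. For $t\in\{0,1,2,\dots\}$ and $x\in\mathbb{Z}$ let $f_t(x)=\mathbb{P}(x\in\zeta_t^{O})$. Then for every $t\ge 0$, the function $f_t:\mathbb{Z}\to[0,1]$ is even and is decreasing (in the non-strict sense) in $|x|$; that is, $f_t(x)=f_t(-x)$ for all $x\in\mathbb{Z}$, and $f_t(x)\ge f_t(x+1)$ for all integers $x\ge 0$.
   Context: An integer interval is a set of consecutive integers. For $\zeta\subseteq\mathbb{Z}$, let $\mathbf{I}(\zeta)$ be the set of all integer intervals that are subsets of $\zeta$, including the empty set, and write $\mathbf{I}=\mathbf{I}(\mathbb{Z})$. Let $R(\zeta)=\sup\zeta$ and $L(\zeta)=\inf\zeta$. Let $(N_t^{L}: t\ge 0)$ and $(N_t^{R}: t\ge 0)$ be independent collections of i.i.d. geometric random variables, all with $\mathbb{P}(N=n)=(1-p)p^{n-1}$ for $n=1,2,\dots$, where $p\in(0,1)$ is called the expansion parameter. The standard specifications randomly fluctuating intervals process with parameter $p$ is the discrete-time Markov process $(\zeta_t: t=0,1,2,\dots)$ on $\mathbf{I}$ (started from a finite interval, so that all its states are finite) defined as follows. Given $\zeta_t$, choose $\tilde\zeta_t$ uniformly at random from the finite set $\mathbf{I}(\zeta_t)$ (each element, including $\emptyset$, having probability $1/|\mathbf{I}(\zeta_t)|$), where the choice of $\tilde\zeta_t$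 depends on the past only through $\zeta_t$, and where $N_t^{L},N_t^{R}$ are independent of the past and of $\tilde\zeta_t$. If $\tilde\zeta_t\neq\emptyset$, set $$\zeta_{t+1}=\{L(\tilde\zeta_t)-N_t^{L},\,L(\tilde\zeta_t)-N_t^{L}+1,\,\dots,\,R(\tilde\zeta_t)+N_t^{R}\};$$ if $\tilde\zeta_t=\emptyset$, set $\zeta_k=\emptyset$ for all $k\ge t+1$ (so $\emptyset$ is absorbing). *)

theory Defs
  imports "HOL-Probability.Probability"
begin

definition int_interval :: "int set \<Rightarrow> bool" where
  "int_interval A \<longleftrightarrow> (\<forall>a\<in>A. \<forall>b\<in>A. \<forall>c. a \<le> c \<and> c \<le> b \<longrightarrow> c \<in> A)"

definition subintervals :: "int set \<Rightarrow> int set set" where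
  "subintervals A = {B. int_interval B \<and> B \<subseteq> A}"

text \<open>The complete discrete record of what happened before the choice at time \<open>t\<close>.\<close>

definition past ::
  "(nat \<Rightarrow> 'a \<Rightarrow> int set) \<Rightarrow> (nat \<Rightarrow> 'a \<Rightarrow> int set) \<Rightarrow> (nat \<Rightarrow> 'a \<Rightarrow> nat) \<Rightarrow> (nat \<Rightarrow> 'a \<Rightarrow> nat) \<Rightarrow>
     nat \<Rightarrow> 'a \<Rightarrow> (int set \<times> int set \<times> nat \<times> nat) list \<times> int set" where
  "past \<zeta> \<xi> NL NR t \<omega> = (map (\<lambda>s. (\<zeta> s \<omega>, \<xi> s \<omega>, NL s \<omega>, NR s \<omega>)) [0..<t], \<zeta> t \<omega>)"

text \<open>The process \<open>\<zeta>\<close> on an arbitrary probability space that carries the auxiliary choices: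
  \<open>\<xi> t\<close> is the uniformly chosen subinterval of \<open>\<zeta> t\<close>, and \<open>NL t\<close>, \<open>NR t\<close> are the
  expansions to the left and to the right. The states lie in the countable set of finite
  integer intervals, so all random variables are discrete, and conditioning on the past means
  conditioning on each value \<open>h\<close> of the record that has positive probability; \<open>snd h\<close> is then
  the current state. The condition \<open>expansions_indep_past\<close> is \<open>indep_var\<close> unfolded, because
  \<open>indep_var\<close> needs both variables to have the same value type.\<close>

locale standard_rfi_process = prob_space M
  for M :: "'a measure" +
  fixes p :: real
    and A\<^sub>0 :: "int set"
    and \<zeta> \<xi> :: "nat \<Rightarrow> 'a \<Rightarrow> int set"
    and NL NR :: "nat \<Rightarrow> 'a \<Rightarrow> nat"
  assumes state_measurable:
      "\<And>t. \<zeta> t \<in> measurable M (count_space {A. finite A \<and> int_interval A})"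
    and choice_measurable:
      "\<And>t. \<xi> t \<in> measurable M (count_space {A. finite A \<and> int_interval A})"
    and expansions_indep:
      "indep_vars (\<lambda>_. count_space UNIV) (\<lambda>(left, t). if left then NL t else NR t)
         (UNIV :: (bool \<times> nat) set)"
    and left_geometric:
      "\<And>t n. n \<ge> 1 \<Longrightarrow> \<P>(\<omega> in M. NL t \<omega> = n) = (1 - p) * p ^ (n - 1)"
    and right_geometric:
      "\<And>t n. n \<ge> 1 \<Longrightarrow> \<P>(\<omega> in M. NR t \<omega> = n) = (1 - p) * p ^ (n - 1)"
    and initial: "\<And>\<omega>. \<omega> \<in> space M \<Longrightarrow> \<zeta> 0 \<omega> = A\<^sub>0"
    and choice_in: "\<And>t \<omega>. \<omega> \<in> space M \<Longrightarrow> \<xi> t \<omega> \<in> subintervals (\<zeta> t \<omega>)"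
    and choice_uniform:
      "\<And>t h B. \<P>(\<omega> in M. past \<zeta> \<xi> NL NR t \<omega> = h) > 0 \<Longrightarrow> B \<in> subintervals (snd h) \<Longrightarrow>
         \<P>(\<omega> in M. \<xi> t \<omega> = B \<bar> past \<zeta> \<xi> NL NR t \<omega> = h) = 1 / real (card (subintervals (snd h)))"
    and expansions_indep_past:
      "\<And>t. indep_set (range (\<lambda>S. (\<lambda>\<omega>. (NL t \<omega>, NR t \<omega>)) -` S \<inter> space M))
                      (range (\<lambda>S. (\<lambda>\<omega>. (past \<zeta> \<xi> NL NR t \<omega>, \<xi> t \<omega>)) -` S \<inter> space M))"
    and expand:
      "\<And>t \<omega>. \<omega> \<in> space M \<Longrightarrow> \<xi> t \<omega> \<noteq> {} \<Longrightarrow>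
         \<zeta> (Suc t) \<omega> = {Inf (\<xi> t \<omega>) - int (NL t \<omega>) .. Sup (\<xi> t \<omega>) + int (NR t \<omega>)}"
    and absorb:
      "\<And>t k \<omega>. \<omega> \<in> space M \<Longrightarrow> \<xi> t \<omega> = {} \<Longrightarrow> k \<ge> Suc t \<Longrightarrow> \<zeta> k \<omega> = {}"

end

(* Reflect the integers about c / 2. If a target interval J has its centre on the same side of c / 2
   as I, then J meets I in a longer interval than the mirror image of J does, and the probability of
   moving from I to J depends on J only through its length and the length of the overlap of I with
   the interior of J. Hence moving from I to J is at least as likely as moving to the mirror image
   of J. By induction on time, every interval whose centre lies on the side of c / 2 containing 0 is
   at least as likely a state as its mirror image, and therefore so is the event of covering x
   compared with that of covering c - x. Evenness is the case c = 0 (where 0 lies on both sides);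
   c = -1 compares x with -1 - x, which by evenness is x + 1. *)
theory Submission
  imports Defs
begin

section \<open>Finite integer intervals\<close>

lemma finite_int_interval_eq_atLeastAtMost:
  assumes "finite A" "int_interval A" "A \<noteq> {}"
  shows "A = {Min A..Max A}" "Min A \<le> Max A"
proof -
  show "A = {Min A..Max A}"
  proof
    show "A \<subseteq> {Min A..Max A}" using assms by auto
    show "{Min A..Max A} \<subseteq> A"
      using assms Min_in[of A] Max_in[of A] unfolding int_interval_def by (meson atLeastAtMost_iff subsetI)
  qed
  show "Min A \<le> Max A" using assms by simp
qed

lemma int_interval_atLeastAtMost [simp]: "int_interval {l..r}"
  by (auto simp: int_interval_def)

lemma countable_finite_int_intervals: "countable {A. finite A \<and> int_interval A}"
proof (rule countable_subset)
  show "{A. finite A \<and> int_interval A} \<subseteq> insert {} (range (\<lambda>(l, r). {l..r}))"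
  proof
    fix A :: "int set"
    assume "A \<in> {A. finite A \<and> int_interval A}"
    hence "A = {} \<or> A = (\<lambda>(l, r). {l..r}) (Min A, Max A)"
      using finite_int_interval_eq_atLeastAtMost(1)[of A] by auto
    thus "A \<in> insert {} (range (\<lambda>(l, r). {l..r}))" by blast
  qed
  show "countable (insert {} (range (\<lambda>(l, r). {l..r :: int})))"
    by (intro countable_insert countable_image countableI_type)
qed

lemma finite_subintervals: "finite A \<Longrightarrow> finite (subintervals A)"
  by (rule finite_subset[of _ "Pow A"]) (auto simp: subintervals_def)

lemma card_subintervals_pos: "finite A \<Longrightarrow> card (subintervals A) > 0"
proof -
  assume "finite A"
  moreover have "{} \<in> subintervals A" by (simp add: subintervals_def int_interval_def)
  ultimately show ?thesis using finite_subintervals[of A] by (auto simp only: card_gt_0_iff)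
qed

lemma int_interval_reflect:
  fixes c :: int
  assumes "int_interval A"
  shows "int_interval ((\<lambda>y. c - y) ` A)"
  unfolding int_interval_def
proof (intro ballI allI impI)
  fix a b z
  assume "a \<in> (\<lambda>y. c - y) ` A" "b \<in> (\<lambda>y. c - y) ` A" "a \<le> z \<and> z \<le> b"
  then obtain a' b' where "a' \<in> A" "b' \<in> A" "b' \<le> c - z" "c - z \<le> a'" by auto
  hence "c - z \<in> A" using assms unfolding int_interval_def by blast
  thus "z \<in> (\<lambda>y. c - y) ` A" by (intro image_eqI[of _ _ "c - z"]) auto
qed

text \<open>The map \<open>y \<mapsto> c - y\<close> is an involution taking subintervals to
  subintervals, so it matches the two families. This makes the uniform choice blind to
  reflection.\<close>

lemma card_subintervals_reflect:
  fixes c :: int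
  shows "card (subintervals {c - r..c - l}) = card (subintervals {l..r})"
proof -
  have image: "(\<lambda>y. c - y) ` A \<in> subintervals {c - b..c - a}"
    if "A \<in> subintervals {a..b}" for A and a b :: int
    using that int_interval_reflect[of A c] by (auto simp: subintervals_def)
  have twice: "(\<lambda>y. c - y) ` (\<lambda>y. c - y) ` A = A" for A
    by (simp add: image_image)
  have "bij_betw ((`) (\<lambda>y. c - y)) (subintervals {c - r..c - l}) (subintervals {l..r})"
    using image[of _ "c - r" "c - l"] image[of _ l r]
    by (intro bij_betw_byWitness[where f' = "(`) (\<lambda>y. c - y)"])
       (auto simp only: twice diff_diff_eq2 add_diff_cancel_left')
  thus ?thesis by (rule bij_betw_same_card)
qed

section \<open>Reflections of weighted intervals\<close>

text \<open>Each nonempty finite interval has exactly one such endpoint pair. The empty state is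
  left out: it covers no point and never leads back to a nonempty state.\<close>

definition intervals :: "(int \<times> int) set" where
  "intervals = {(l, r). l \<le> r}"

definition reflect :: "int \<Rightarrow> int \<times> int \<Rightarrow> int \<times> int" where
  "reflect c = (\<lambda>(l, r). (c - r, c - l))"

lemma reflect_reflect [simp]: "reflect c (reflect c I) = I"
  by (simp add: reflect_def split: prod.split)

lemma reflect_in_intervals [simp]: "reflect c I \<in> intervals \<longleftrightarrow> I \<in> intervals"
  by (auto simp: reflect_def intervals_def split: prod.split)

lemma bij_betw_reflect: "bij_betw (reflect c) intervals intervals"
  by (rule bij_betw_byWitness[where f' = "reflect c"]) auto

text \<open>Pairing each interval with its mirror image turns this into the two-term rearrangement
  inequality.\<close>

lemma nn_integral_reflect_le:
  fixes m G :: "int \<times> int \<Rightarrow> real"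
  assumes m: "\<And>I. m I \<ge> 0" and G: "\<And>I. G I \<ge> 0"
    and same_order: "\<And>I. I \<in> intervals \<Longrightarrow> (m I - m (reflect c I)) * (G I - G (reflect c I)) \<ge> 0"
  shows "(\<integral>\<^sup>+I. ennreal (m I * G (reflect c I)) \<partial>count_space intervals)
       \<le> (\<integral>\<^sup>+I. ennreal (m I * G I) \<partial>count_space intervals)"
    (is "?A \<le> ?B")
proof -
  have swap: "(\<integral>\<^sup>+I. h (reflect c I) \<partial>count_space intervals) = (\<integral>\<^sup>+I. h I \<partial>count_space intervals)"
    for h :: "int \<times> int \<Rightarrow> ennreal"
    by (rule nn_integral_bij_count_space[OF bij_betw_reflect])
  have A: "(\<integral>\<^sup>+I. ennreal (m (reflect c I) * G I) \<partial>count_space intervals) = ?A"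
    using swap[of "\<lambda>I. ennreal (m I * G (reflect c I))"] by simp
  have B: "(\<integral>\<^sup>+I. ennreal (m (reflect c I) * G (reflect c I)) \<partial>count_space intervals) = ?B"
    using swap[of "\<lambda>I. ennreal (m I * G I)"] by simp
  \<comment> \<open>Doubling both sides puts \<open>I\<close> and its mirror image into one summand,
    so no representative of each mirror pair has to be chosen. The factor 2 can be cancelled at the
    end even if the values are infinite.\<close>
  have "?A + ?A = (\<integral>\<^sup>+I. ennreal (m I * G (reflect c I)) + ennreal (m (reflect c I) * G I)
      \<partial>count_space intervals)"
    by (subst nn_integral_add) (simp_all add: A)
  also have "\<dots> \<le> (\<integral>\<^sup>+I. ennreal (m I * G I) + ennreal (m (reflect c I) * G (reflect c I))
      \<partial>count_space intervals)"
  proof (rule nn_integral_mono)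
    fix I assume "I \<in> space (count_space intervals)"
    hence "m I * G (reflect c I) + m (reflect c I) * G I
        \<le> m I * G I + m (reflect c I) * G (reflect c I)"
      using same_order[of I] by (simp add: algebra_simps)
    thus "ennreal (m I * G (reflect c I)) + ennreal (m (reflect c I) * G I)
        \<le> ennreal (m I * G I) + ennreal (m (reflect c I) * G (reflect c I))"
      by (simp add: m G ennreal_plus[symmetric] del: ennreal_plus)
  qed
  also have "\<dots> = ?B + ?B"
    by (subst nn_integral_add) (simp_all add: B)
  finally have "2 * ?A \<le> 2 * ?B" by (simp add: mult_2)
  thus ?thesis by (simp add: ennreal_mult_le_mult_iff)
qed

section \<open>The transition probabilities\<close>

text \<open>For \<open>x > y\<close> this is empty, so an empty overlap of two intervals needs no
  separate case.\<close>

definition choices :: "int \<Rightarrow> int \<Rightarrow> (int \<times> int) set" where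
  "choices x y = {(u, v). x \<le> u \<and> u \<le> v \<and> v \<le> y}"

lemma finite_choices [simp]: "finite (choices x y)"
  by (rule finite_subset[of _ "{x..y} \<times> {x..y}"]) (auto simp: choices_def)

text \<open>The choice \<open>{u..v}\<close> is expanded to \<open>{a..b}\<close> with probability
  \<open>(1 - p) * p ^ (u - a - 1) * ((1 - p) * p ^ (b - v - 1))\<close>, which depends only on the lengths of
  the two intervals. As both expansions are positive, \<open>u\<close> and \<open>v\<close> lie strictly between \<open>a\<close> and
  \<open>b\<close>.\<close>

definition choice_weight :: "real \<Rightarrow> int \<Rightarrow> int \<Rightarrow> int \<times> int \<Rightarrow> real" where
  "choice_weight p a b = (\<lambda>(u, v). (1 - p)\<^sup>2 * p ^ nat (b - a - 2 - (v - u)))"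

text \<open>The target \<open>{a..b}\<close> comes first and the source last, so that for a fixed
  target this is a weight on endpoint pairs, to which \<open>nn_integral_reflect_le\<close> applies.
  The range of the sum is the overlap of the source with the interior of the target.\<close>

definition transition :: "real \<Rightarrow> int \<Rightarrow> int \<Rightarrow> int \<times> int \<Rightarrow> real" where
  "transition p a b = (\<lambda>(l, r). (\<Sum>uv\<in>choices (max (a + 1) l) (min (b - 1) r). choice_weight p a b uv)
     / real (card (subintervals {l..r})))"

lemma choice_weight_nonneg: "0 < p \<Longrightarrow> p < 1 \<Longrightarrow> choice_weight p a b uv \<ge> 0"
  by (simp add: choice_weight_def split: prod.split)

lemma transition_nonneg: "0 < p \<Longrightarrow> p < 1 \<Longrightarrow> transition p a b I \<ge> 0"
  by (auto simp: transition_def choice_weight_nonneg intro!: divide_nonneg_nonneg sum_nonneg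
      split: prod.split)

text \<open>Translation by \<open>x' - x\<close> embeds the shorter range into the longer one and
  keeps every weight, since weights see only lengths. The choices not reached contribute nonnegative
  terms.\<close>

lemma sum_choice_weight_mono:
  assumes p: "0 < p" "p < 1" and le: "y - x \<le> y' - x'" and ab: "b - a = b' - a'"
  shows "(\<Sum>uv\<in>choices x y. choice_weight p a b uv) \<le> (\<Sum>uv\<in>choices x' y'. choice_weight p a' b' uv)"
proof -
  define \<tau> where "\<tau> = (\<lambda>(u, v). (u + (x' - x), v + (x' - x)))"
  have inj: "inj_on \<tau> (choices x y)" by (auto simp: \<tau>_def inj_on_def)
  have "(\<Sum>uv\<in>choices x y. choice_weight p a b uv) = (\<Sum>uv\<in>\<tau> ` choices x y. choice_weight p a' b' uv)"
    by (subst sum.reindex[OF inj])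
       (auto intro!: sum.cong simp: \<tau>_def choice_weight_def ab split: prod.split)
  also have "\<dots> \<le> (\<Sum>uv\<in>choices x' y'. choice_weight p a' b' uv)"
    using le by (intro sum_mono2 finite_choices choice_weight_nonneg p) (auto simp: \<tau>_def choices_def)
  finally show ?thesis .
qed

text \<open>The two overlaps have equal length, so \<open>sum_choice_weight_mono\<close> applies in
  both directions. This trades a reflection of the source for a reflection of the target.\<close>

lemma transition_reflect:
  assumes "0 < p" "p < 1"
  shows "transition p a b (reflect c I) = transition p (c - b) (c - a) I"
proof -
  obtain l r where I: "I = (l, r)" by (cases I)
  have "(\<Sum>uv\<in>choices (max (a + 1) (c - r)) (min (b - 1) (c - l)). choice_weight p a b uv)
      = (\<Sum>uv\<in>choices (max (c - b + 1) l) (min (c - a - 1) r). choice_weight p (c - b) (c - a) uv)"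
    by (intro antisym sum_choice_weight_mono assms) (auto simp: max_def min_def)
  thus ?thesis
    by (simp add: I transition_def reflect_def card_subintervals_reflect)
qed

text \<open>Of two mirror-image targets, the one whose centre lies on the same side of \<open>c / 2\<close> as the
  centre of \<open>{l..r}\<close> has the longer overlap with \<open>{l..r}\<close>.\<close>

lemma transition_same_side:
  assumes p: "0 < p" "p < 1" and s: "s = 1 \<or> s = (-1 :: int)"
    and "s * (a + b - c) \<ge> 0" "s * (l + r - c) \<ge> 0"
  shows "transition p (c - b) (c - a) (l, r) \<le> transition p a b (l, r)"
proof -
  have "min (c - a - 1) r - max (c - b + 1) l \<le> min (b - 1) r - max (a + 1) l"
    using s assms(4,5) by (auto simp: max_def min_def)
  thus ?thesis unfolding transition_def
    by (auto intro!: divide_right_mono sum_choice_weight_mono p)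
qed

section \<open>The law of the process\<close>

context standard_rfi_process
begin

section \<open>Measurability and the record of the past\<close>

lemma zeta_finite_int_interval:
  "\<omega> \<in> space M \<Longrightarrow> finite (\<zeta> t \<omega>)" "\<omega> \<in> space M \<Longrightarrow> int_interval (\<zeta> t \<omega>)"
  using measurable_space[OF state_measurable[of t]] by auto

lemma xi_finite_int_interval:
  "\<omega> \<in> space M \<Longrightarrow> finite (\<xi> t \<omega>)" "\<omega> \<in> space M \<Longrightarrow> int_interval (\<xi> t \<omega>)"
  using measurable_space[OF choice_measurable[of t]] by auto

lemma zeta_measurable [measurable]: "\<zeta> t \<in> measurable M (count_space UNIV)"
  using measurable_compose[OF state_measurable[of t], of "\<lambda>x. x" "count_space UNIV"] by simp

lemma xi_measurable [measurable]: "\<xi> t \<in> measurable M (count_space UNIV)"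
  using measurable_compose[OF choice_measurable[of t], of "\<lambda>x. x" "count_space UNIV"] by simp

lemma NL_measurable [measurable]: "NL t \<in> measurable M (count_space UNIV)"
  and NR_measurable [measurable]: "NR t \<in> measurable M (count_space UNIV)"
proof -
  have "(case i of (left, t) \<Rightarrow> if left then NL t else NR t) \<in> measurable M (count_space UNIV)" for i
    using expansions_indep unfolding indep_vars_def by blast
  from this[of "(True, t)"] this[of "(False, t)"]
  show "NL t \<in> measurable M (count_space UNIV)" "NR t \<in> measurable M (count_space UNIV)"
    by simp_all
qed

text \<open>The type \<open>int set\<close> is uncountable; restricting to finite intervals leaves
  countably many records, so probabilities can be summed over them.\<close>

abbreviation past_values :: "((int set \<times> int set \<times> nat \<times> nat) list \<times> int set) set" where
  "past_values \<equiv> lists ({A. finite A \<and> int_interval A} \<times> {A. finite A \<and> int_interval A} \<times> UNIV \<times> UNIV)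
     \<times> {A. finite A \<and> int_interval A}"

lemma countable_past_values: "countable past_values"
  by (intro countable_SIGMA countable_lists countable_finite_int_intervals countableI_type)

lemma past_in_past_values: "\<omega> \<in> space M \<Longrightarrow> past \<zeta> \<xi> NL NR t \<omega> \<in> past_values"
  by (auto simp: past_def zeta_finite_int_interval xi_finite_int_interval)

text \<open>A record of the right length fixes finitely many measurable coordinates; one of any
  other length is never attained.\<close>

lemma past_sets [measurable]: "{\<omega> \<in> space M. past \<zeta> \<xi> NL NR t \<omega> = h} \<in> sets M"
proof (cases "length (fst h) = t")
  case True
  hence "{\<omega> \<in> space M. past \<zeta> \<xi> NL NR t \<omega> = h} =
     {\<omega> \<in> space M. (\<forall>s\<in>{..<t}. \<zeta> s \<omega> = fst (fst h ! s) \<and> \<xi> s \<omega> = fst (snd (fst h ! s)) \<and>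
        NL s \<omega> = fst (snd (snd (fst h ! s))) \<and> NR s \<omega> = snd (snd (snd (fst h ! s)))) \<and> \<zeta> t \<omega> = snd h}"
    by (auto simp: past_def list_eq_iff_nth_eq prod_eq_iff)
  also have "\<dots> \<in> sets M" by measurable
  finally show ?thesis .
next
  case False
  hence "{\<omega> \<in> space M. past \<zeta> \<xi> NL NR t \<omega> = h} = {}" by (auto simp: past_def)
  thus ?thesis by (simp only: sets.empty_sets)
qed

text \<open>Uniformity is assumed given the whole past. The conditional probability is the same for
  all records ending in \<open>A\<close>, so summing over these countably many records leaves
  conditioning on the current state alone.\<close>

lemma prob_choice:
  assumes "finite A" "int_interval A" "B \<in> subintervals A"
  shows "\<P>(\<omega> in M. \<zeta> t \<omega> = A \<and> \<xi> t \<omega> = B) = \<P>(\<omega> in M. \<zeta> t \<omega> = A) / real (card (subintervals A))"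
proof -
  define H where "H = {h \<in> past_values. snd h = A}"
  have H: "countable H"
    by (rule countable_subset[OF _ countable_past_values]) (auto simp: H_def)
  let ?E = "\<lambda>h. {\<omega> \<in> space M. past \<zeta> \<xi> NL NR t \<omega> = h}"
  let ?F = "\<lambda>h. {\<omega> \<in> space M. \<xi> t \<omega> = B \<and> past \<zeta> \<xi> NL NR t \<omega> = h}"
  have F_sets: "?F h \<in> sets M" for h
  proof -
    have "?F h = {\<omega> \<in> space M. \<xi> t \<omega> = B} \<inter> ?E h" by auto
    also have "\<dots> \<in> sets M" by (intro sets.Int past_sets) measurable
    finally show ?thesis .
  qed
  have snd_past: "snd (past \<zeta> \<xi> NL NR t \<omega>) = \<zeta> t \<omega>" for \<omega> by (simp add: past_def)
  have past_H: "past \<zeta> \<xi> NL NR t \<omega> \<in> H \<longleftrightarrow> \<zeta> t \<omega> = A" if "\<omega> \<in> space M" for \<omega>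
    using past_in_past_values[OF that, of t] unfolding H_def snd_past[symmetric] by blast
  have E: "{\<omega> \<in> space M. \<zeta> t \<omega> = A} = (\<Union>h\<in>H. ?E h)"
    using past_H by blast
  have F: "{\<omega> \<in> space M. \<zeta> t \<omega> = A \<and> \<xi> t \<omega> = B} = (\<Union>h\<in>H. ?F h)"
    using past_H by blast
  define N where "N = real (card (subintervals A))"
  have N: "N > 0" using card_subintervals_pos[OF assms(1)] by (simp add: N_def)
  have EF: "prob (?F h) = (1 / N) * prob (?E h)" if "h \<in> H" for h
  proof (cases "prob (?E h) > 0")
    case True
    have "snd h = A" using that by (simp add: H_def)
    hence "prob (?F h) / prob (?E h) = 1 / N"
      using choice_uniform[OF True, of B] assms(3) by (simp add: cond_prob_def N_def)
    thus ?thesis using True by (simp add: field_simps)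
  next
    \<comment> \<open>\<open>choice_uniform\<close> says nothing about records of probability zero,
      but there both sides vanish.\<close>
    case False
    hence 0: "prob (?E h) = 0" using measure_nonneg[of M "?E h"] by linarith
    have "prob (?F h) \<le> prob (?E h)" by (rule finite_measure_mono) auto
    thus ?thesis using 0 measure_nonneg[of M "?F h"] by simp
  qed
  have "emeasure M {\<omega> \<in> space M. \<zeta> t \<omega> = A \<and> \<xi> t \<omega> = B} = (\<integral>\<^sup>+h. emeasure M (?F h) \<partial>count_space H)"
    unfolding F using F_sets
    by (intro emeasure_UN_countable H) (auto simp: disjoint_family_on_def)
  also have "\<dots> = (\<integral>\<^sup>+h. ennreal (1 / N) * emeasure M (?E h) \<partial>count_space H)"
    using N by (intro nn_integral_cong) (simp add: emeasure_eq_measure EF ennreal_mult[symmetric] del: times_divide_eq_left)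
  also have "\<dots> = ennreal (1 / N) * (\<integral>\<^sup>+h. emeasure M (?E h) \<partial>count_space H)"
    by (rule nn_integral_cmult) simp
  also have "(\<integral>\<^sup>+h. emeasure M (?E h) \<partial>count_space H) = emeasure M {\<omega> \<in> space M. \<zeta> t \<omega> = A}"
    unfolding E
    by (rule emeasure_UN_countable[symmetric]) (auto simp: disjoint_family_on_def H past_sets)
  finally show ?thesis
    using N by (simp add: emeasure_eq_measure ennreal_mult[symmetric] N_def)
qed

section \<open>Total probability over the current state\<close>

definition law :: "nat \<Rightarrow> int \<times> int \<Rightarrow> real" where
  "law t = (\<lambda>(l, r). \<P>(\<omega> in M. \<zeta> t \<omega> = {l..r}))"

lemma law_nonneg: "law t I \<ge> 0"
  by (simp add: law_def split: prod.split)

text \<open>Since \<open>P\<close> rules out the empty state, the events for the pairs in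
  \<open>intervals\<close> partition the event \<open>P\<close>. Working in \<open>ennreal\<close>
  avoids summability conditions.\<close>

lemma emeasure_by_state:
  assumes E: "{\<omega> \<in> space M. P \<omega>} \<in> sets M" and ne: "\<And>\<omega>. \<omega> \<in> space M \<Longrightarrow> P \<omega> \<Longrightarrow> \<zeta> t \<omega> \<noteq> {}"
  shows "emeasure M {\<omega> \<in> space M. P \<omega>} =
    (\<integral>\<^sup>+I. ennreal (\<P>(\<omega> in M. \<zeta> t \<omega> = {fst I..snd I} \<and> P \<omega>)) \<partial>count_space intervals)"
proof -
  let ?X = "\<lambda>I. {\<omega> \<in> space M. \<zeta> t \<omega> = {fst I..snd I} \<and> P \<omega>}"
  have "{\<omega> \<in> space M. P \<omega>} = (\<Union>I\<in>intervals. ?X I)"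
  proof (intro equalityI subsetI)
    fix \<omega> assume \<omega>: "\<omega> \<in> {\<omega> \<in> space M. P \<omega>}"
    hence "\<zeta> t \<omega> = {Min (\<zeta> t \<omega>)..Max (\<zeta> t \<omega>)}" "Min (\<zeta> t \<omega>) \<le> Max (\<zeta> t \<omega>)"
      using finite_int_interval_eq_atLeastAtMost[of "\<zeta> t \<omega>"] zeta_finite_int_interval[of \<omega> t] ne
      by auto
    with \<omega> show "\<omega> \<in> (\<Union>I\<in>intervals. ?X I)"
      by (auto simp: intervals_def intro!: bexI[of _ "(Min (\<zeta> t \<omega>), Max (\<zeta> t \<omega>))"])
  qed auto
  also have "emeasure M \<dots> = (\<integral>\<^sup>+I. emeasure M (?X I) \<partial>count_space intervals)"
  proof (rule emeasure_UN_countable)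
    fix I
    have "?X I = {\<omega> \<in> space M. \<zeta> t \<omega> = {fst I..snd I}} \<inter> {\<omega> \<in> space M. P \<omega>}" by auto
    also have "\<dots> \<in> sets M" by (intro sets.Int E) measurable
    finally show "?X I \<in> sets M" .
  next
    show "disjoint_family_on ?X intervals"
      by (auto simp: disjoint_family_on_def intervals_def)
  qed simp_all
  finally show ?thesis by (simp add: emeasure_eq_measure)
qed

lemma emeasure_mem_state:
  "emeasure M {\<omega> \<in> space M. x \<in> \<zeta> t \<omega>} =
    (\<integral>\<^sup>+I. ennreal (law t I * indicator {fst I..snd I} x) \<partial>count_space intervals)"
proof -
  have "emeasure M {\<omega> \<in> space M. x \<in> \<zeta> t \<omega>} =
    (\<integral>\<^sup>+I. ennreal (\<P>(\<omega> in M. \<zeta> t \<omega> = {fst I..snd I} \<and> x \<in> \<zeta> t \<omega>)) \<partial>count_space intervals)"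
  proof (rule emeasure_by_state)
    have "{\<omega> \<in> space M. x \<in> \<zeta> t \<omega>} = \<zeta> t -` {A. x \<in> A} \<inter> space M" by auto
    thus "{\<omega> \<in> space M. x \<in> \<zeta> t \<omega>} \<in> sets M"
      using measurable_sets[OF zeta_measurable, of "{A. x \<in> A}" t] by (simp del: vimage_Collect_eq)
  qed auto
  also have "\<dots> = (\<integral>\<^sup>+I. ennreal (law t I * indicator {fst I..snd I} x) \<partial>count_space intervals)"
  proof (rule nn_integral_cong)
    fix I :: "int \<times> int"
    have "{\<omega> \<in> space M. \<zeta> t \<omega> = {fst I..snd I} \<and> x \<in> \<zeta> t \<omega>} =
      (if x \<in> {fst I..snd I} then {\<omega> \<in> space M. \<zeta> t \<omega> = {fst I..snd I}} else {})"
      by (cases "x \<in> {fst I..snd I}") (simp_all only: if_True if_False, blast+)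
    thus "ennreal (\<P>(\<omega> in M. \<zeta> t \<omega> = {fst I..snd I} \<and> x \<in> \<zeta> t \<omega>)) =
        ennreal (law t I * indicator {fst I..snd I} x)"
      by (simp add: law_def case_prod_unfold)
  qed
  finally show ?thesis .
qed

lemma emeasure_choice:
  assumes "u \<le> v"
  shows "emeasure M {\<omega> \<in> space M. \<xi> t \<omega> = {u..v}} =
    (\<integral>\<^sup>+I. ennreal (law t I * ((if fst I \<le> u \<and> v \<le> snd I then 1 else 0)
        / real (card (subintervals {fst I..snd I})))) \<partial>count_space intervals)"
proof -
  have sub: "{u..v} \<in> subintervals A \<longleftrightarrow> {u..v} \<subseteq> A" for A
    by (simp add: subintervals_def)
  have "emeasure M {\<omega> \<in> space M. \<xi> t \<omega> = {u..v}} =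
    (\<integral>\<^sup>+I. ennreal (\<P>(\<omega> in M. \<zeta> t \<omega> = {fst I..snd I} \<and> \<xi> t \<omega> = {u..v})) \<partial>count_space intervals)"
  proof (rule emeasure_by_state)
    fix \<omega> assume "\<omega> \<in> space M" "\<xi> t \<omega> = {u..v}"
    with choice_in[of \<omega> t] assms show "\<zeta> t \<omega> \<noteq> {}" by (auto simp: sub)
  qed measurable
  also have "\<dots> = (\<integral>\<^sup>+I. ennreal (law t I * ((if fst I \<le> u \<and> v \<le> snd I then 1 else 0)
        / real (card (subintervals {fst I..snd I})))) \<partial>count_space intervals)"
  proof (rule nn_integral_cong)
    fix I :: "int \<times> int"
    show "ennreal (\<P>(\<omega> in M. \<zeta> t \<omega> = {fst I..snd I} \<and> \<xi> t \<omega> = {u..v})) =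
       ennreal (law t I * ((if fst I \<le> u \<and> v \<le> snd I then 1 else 0)
         / real (card (subintervals {fst I..snd I}))))"
    proof (cases "fst I \<le> u \<and> v \<le> snd I")
      case True
      hence "{u..v} \<in> subintervals {fst I..snd I}" by (auto simp: sub)
      from prob_choice[OF _ _ this, of t] True show ?thesis
        by (simp add: law_def case_prod_unfold)
    next
      case False
      have "{\<omega> \<in> space M. \<zeta> t \<omega> = {fst I..snd I} \<and> \<xi> t \<omega> = {u..v}} = {}"
        using choice_in[of _ t] False assms by (fastforce simp: subintervals_def)
      thus ?thesis using False by (simp only: measure_empty) simp
    qed
  qed
  finally show ?thesis .
qed

section \<open>The one-step transition law\<close>

text \<open>The masses at \<open>n \<ge> 1\<close> already sum to 1. This excludes, up to a null
  set, the value 0 that the type \<open>nat\<close> permits.\<close>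

lemma geometric_not_zero:
  fixes X :: "'a \<Rightarrow> nat"
  assumes p: "0 < p" "p < 1" and X [measurable]: "X \<in> measurable M (count_space UNIV)"
    and geom: "\<And>n. n \<ge> 1 \<Longrightarrow> \<P>(\<omega> in M. X \<omega> = n) = (1 - p) * p ^ (n - 1)"
  shows "\<P>(\<omega> in M. X \<omega> = 0) = 0"
proof -
  have "(\<lambda>n. prob {\<omega> \<in> space M. X \<omega> = n}) sums prob (\<Union>n. {\<omega> \<in> space M. X \<omega> = n})"
    by (rule finite_measure_UNION) (auto simp: disjoint_family_on_def)
  also have "(\<Union>n. {\<omega> \<in> space M. X \<omega> = n}) = space M" by auto
  finally have 1: "(\<lambda>n. prob {\<omega> \<in> space M. X \<omega> = n}) sums 1" by (simp add: prob_space)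
  have "(\<lambda>n. (1 - p) * p ^ n) sums ((1 - p) * (1 / (1 - p)))"
    using p by (intro sums_mult geometric_sums) simp
  hence "(\<lambda>n. prob {\<omega> \<in> space M. X \<omega> = Suc n}) sums 1" using p by (simp add: geom)
  hence "(\<lambda>n. prob {\<omega> \<in> space M. X \<omega> = n}) sums (1 + prob {\<omega> \<in> space M. X \<omega> = 0})"
    by (rule sums_Suc)
  with 1 show ?thesis using sums_unique2 by fastforce
qed

text \<open>Two independence assumptions combine: the expansions at time \<open>t\<close> are
  independent of each other, and as a pair they are independent of the past together with the
  choice.\<close>

lemma prob_expansions:
  "\<P>(\<omega> in M. \<xi> t \<omega> = B \<and> NL t \<omega> = i \<and> NR t \<omega> = j) =
    \<P>(\<omega> in M. \<xi> t \<omega> = B) * (\<P>(\<omega> in M. NL t \<omega> = i) * \<P>(\<omega> in M. NR t \<omega> = j))"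
proof -
  let ?L = "{\<omega> \<in> space M. NL t \<omega> = i}" and ?R = "{\<omega> \<in> space M. NR t \<omega> = j}"
  let ?N = "(\<lambda>\<omega>. (NL t \<omega>, NR t \<omega>)) -` {(i, j)} \<inter> space M"
  let ?C = "(\<lambda>\<omega>. (past \<zeta> \<xi> NL NR t \<omega>, \<xi> t \<omega>)) -` (UNIV \<times> {B}) \<inter> space M"
  have "prob (\<Inter>k\<in>{(True, t), (False, t)}. (\<lambda>(left, t). if left then NL t else NR t) k
      -` (if fst k then {i} else {j}) \<inter> space M) =
    (\<Prod>k\<in>{(True, t), (False, t)}. prob ((\<lambda>(left, t). if left then NL t else NR t) k
      -` (if fst k then {i} else {j}) \<inter> space M))"
    by (rule indep_varsD[OF expansions_indep]) auto
  moreover have "NL t -` {i} \<inter> space M = ?L" "NR t -` {j} \<inter> space M = ?R" "?L \<inter> ?R = ?N"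
    by auto
  ultimately have N: "prob ?N = prob ?L * prob ?R" by simp
  have "prob (?N \<inter> ?C) = prob ?N * prob ?C"
    by (rule indep_setD[OF expansions_indep_past]) auto
  moreover have "?C = {\<omega> \<in> space M. \<xi> t \<omega> = B}"
    "?N \<inter> ?C = {\<omega> \<in> space M. \<xi> t \<omega> = B \<and> NL t \<omega> = i \<and> NR t \<omega> = j}" by auto
  ultimately show ?thesis using N by simp
qed

text \<open>The geometric exponents \<open>u - a - 1\<close> and \<open>b - v - 1\<close> add up to
  the exponent in \<open>choice_weight\<close>. If \<open>u = a\<close> or \<open>v = b\<close>, one
  expansion would be 0, which has probability zero.\<close>

lemma prob_choice_expansions:
  assumes p: "0 < p" "p < 1" and "a \<le> u" "u \<le> v" "v \<le> b"
  shows "\<P>(\<omega> in M. \<xi> t \<omega> = {u..v} \<and> NL t \<omega> = nat (u - a) \<and> NR t \<omega> = nat (b - v)) =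
    (if a < u \<and> v < b then \<P>(\<omega> in M. \<xi> t \<omega> = {u..v}) * choice_weight p a b (u, v) else 0)"
proof (cases "a < u \<and> v < b")
  case True
  have "p ^ (nat (u - a) - 1) * p ^ (nat (b - v) - 1) = p ^ nat (b - a - 2 - (v - u))"
    unfolding power_add[symmetric] using True assms by (intro arg_cong[of _ _ "\<lambda>n. p ^ n"]) auto
  moreover have "\<P>(\<omega> in M. NL t \<omega> = nat (u - a)) = (1 - p) * p ^ (nat (u - a) - 1)"
    "\<P>(\<omega> in M. NR t \<omega> = nat (b - v)) = (1 - p) * p ^ (nat (b - v) - 1)"
    by (rule left_geometric right_geometric, use True in linarith)+
  ultimately show ?thesis
    using True by (simp only: prob_expansions choice_weight_def power2_eq_square) simp
next
  case False
  hence "u = a \<or> v = b" using assms by auto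
  thus ?thesis
    using False geometric_not_zero[OF p NL_measurable left_geometric, of t]
      geometric_not_zero[OF p NR_measurable right_geometric, of t]
    by (auto simp: prob_expansions)
qed

lemma prob_step:
  assumes p: "0 < p" "p < 1" and ab: "a \<le> b"
  shows "law (Suc t) (a, b) =
    (\<Sum>uv\<in>choices (a + 1) (b - 1). \<P>(\<omega> in M. \<xi> t \<omega> = {fst uv..snd uv}) * choice_weight p a b uv)"
proof -
  let ?X = "\<lambda>uv. {\<omega> \<in> space M. \<xi> t \<omega> = {fst uv..snd uv} \<and> NL t \<omega> = nat (fst uv - a) \<and>
    NR t \<omega> = nat (b - snd uv)}"
  \<comment> \<open>A zero expansion is only a null event, so an identity between events has to
    allow choices that touch \<open>a\<close> or \<open>b\<close>.\<close>
  have "{\<omega> \<in> space M. \<zeta> (Suc t) \<omega> = {a..b}} = (\<Union>uv\<in>choices a b. ?X uv)"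
  proof (intro equalityI subsetI)
    fix \<omega> assume "\<omega> \<in> {\<omega> \<in> space M. \<zeta> (Suc t) \<omega> = {a..b}}"
    hence \<omega>: "\<omega> \<in> space M" "\<zeta> (Suc t) \<omega> = {a..b}" by auto
    hence ne: "\<xi> t \<omega> \<noteq> {}" using absorb[of \<omega> t "Suc t"] ab by auto
    obtain u v where uv: "\<xi> t \<omega> = {u..v}" "u \<le> v"
      using finite_int_interval_eq_atLeastAtMost xi_finite_int_interval[OF \<omega>(1)] ne by metis
    have "{a..b} = {u - int (NL t \<omega>)..v + int (NR t \<omega>)}"
      using expand[OF \<omega>(1) ne] \<omega>(2) uv by simp
    hence "a = u - int (NL t \<omega>)" "b = v + int (NR t \<omega>)" using ab by auto
    thus "\<omega> \<in> (\<Union>uv\<in>choices a b. ?X uv)"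
      using uv \<omega>(1) by (auto simp: choices_def intro!: bexI[of _ "(u, v)"])
  next
    fix \<omega> assume "\<omega> \<in> (\<Union>uv\<in>choices a b. ?X uv)"
    then obtain u v where uv: "(u, v) \<in> choices a b" "\<omega> \<in> ?X (u, v)" by auto
    hence "\<zeta> (Suc t) \<omega> = {u - int (NL t \<omega>)..v + int (NR t \<omega>)}"
      using expand[of \<omega> t] by (auto simp: choices_def)
    with uv show "\<omega> \<in> {\<omega> \<in> space M. \<zeta> (Suc t) \<omega> = {a..b}}" by (auto simp: choices_def)
  qed
  hence "law (Suc t) (a, b) = prob (\<Union>uv\<in>choices a b. ?X uv)" by (simp add: law_def)
  also have "\<dots> = (\<Sum>uv\<in>choices a b. prob (?X uv))"
  proof (rule finite_measure_finite_Union)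
    show "disjoint_family_on ?X (choices a b)"
      by (auto simp: disjoint_family_on_def choices_def)
  qed auto
  \<comment> \<open>The choices touching \<open>a\<close> or \<open>b\<close> are null events and
    drop out here.\<close>
  also have "\<dots> = (\<Sum>uv\<in>choices (a + 1) (b - 1).
      \<P>(\<omega> in M. \<xi> t \<omega> = {fst uv..snd uv}) * choice_weight p a b uv)"
  proof (rule sum.mono_neutral_cong_right)
    show "choices (a + 1) (b - 1) \<subseteq> choices a b" by (auto simp: choices_def)
    show "\<forall>uv\<in>choices a b - choices (a + 1) (b - 1). prob (?X uv) = 0"
    proof
      fix uv assume uv: "uv \<in> choices a b - choices (a + 1) (b - 1)"
      hence "\<not> (a < fst uv \<and> snd uv < b)" by (auto simp: choices_def)
      thus "prob (?X uv) = 0"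
        using prob_choice_expansions[OF p, of a "fst uv" "snd uv" b t] uv
        by (auto simp: choices_def)
    qed
    fix uv assume "uv \<in> choices (a + 1) (b - 1)"
    hence "a < fst uv \<and> fst uv \<le> snd uv \<and> snd uv < b" by (auto simp: choices_def)
    thus "prob (?X uv) = \<P>(\<omega> in M. \<xi> t \<omega> = {fst uv..snd uv}) * choice_weight p a b uv"
      using prob_choice_expansions[OF p, of a "fst uv" "snd uv" b t] by simp
  qed simp
  finally show ?thesis .
qed

text \<open>Inserting \<open>emeasure_choice\<close> into \<open>prob_step\<close> and exchanging
  the finite sum over choices with the sum over states gives the forward equation with kernel
  \<open>transition\<close>.\<close>

lemma law_Suc:
  assumes p: "0 < p" "p < 1" and ab: "a \<le> b"
  shows "ennreal (law (Suc t) (a, b)) =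
    (\<integral>\<^sup>+I. ennreal (law t I * transition p a b I) \<partial>count_space intervals)"
proof -
  let ?K = "choices (a + 1) (b - 1)"
  let ?q = "\<lambda>uv I. (if fst I \<le> fst uv \<and> snd uv \<le> snd I then 1 else 0)
        / real (card (subintervals {fst I..snd I}))"
  have "ennreal (law (Suc t) (a, b)) =
      (\<Sum>uv\<in>?K. emeasure M {\<omega> \<in> space M. \<xi> t \<omega> = {fst uv..snd uv}} * ennreal (choice_weight p a b uv))"
    unfolding prob_step[OF p ab]
    by (simp add: sum_ennreal[symmetric] emeasure_eq_measure choice_weight_nonneg p ennreal_mult)
  also have "\<dots> = (\<Sum>uv\<in>?K. \<integral>\<^sup>+I. ennreal (law t I * ?q uv I * choice_weight p a b uv) \<partial>count_space intervals)"
  proof (rule sum.cong[OF refl])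
    fix uv assume "uv \<in> ?K"
    hence "fst uv \<le> snd uv" by (auto simp: choices_def)
    thus "emeasure M {\<omega> \<in> space M. \<xi> t \<omega> = {fst uv..snd uv}} * ennreal (choice_weight p a b uv) =
        (\<integral>\<^sup>+I. ennreal (law t I * ?q uv I * choice_weight p a b uv) \<partial>count_space intervals)"
      by (subst emeasure_choice, assumption, subst nn_integral_multc[symmetric])
         (simp_all add: ennreal_mult''[symmetric] choice_weight_nonneg p)
  qed
  also have "\<dots> = (\<integral>\<^sup>+I. (\<Sum>uv\<in>?K. ennreal (law t I * ?q uv I * choice_weight p a b uv)) \<partial>count_space intervals)"
    by (rule nn_integral_sum[symmetric]) simp
  also have "\<dots> = (\<integral>\<^sup>+I. ennreal (law t I * transition p a b I) \<partial>count_space intervals)"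
  proof (rule nn_integral_cong)
    fix I :: "int \<times> int"
    obtain l r where I: "I = (l, r)" by (cases I)
    \<comment> \<open>Choices not contained in \<open>{l..r}\<close> have \<open>?q\<close> equal to
      0; the others run through the overlap in \<open>transition\<close>.\<close>
    have "(\<Sum>uv\<in>?K. ?q uv I * choice_weight p a b uv) =
        (\<Sum>uv\<in>choices (max (a + 1) l) (min (b - 1) r).
          choice_weight p a b uv / real (card (subintervals {l..r})))"
      by (rule sum.mono_neutral_cong_right[OF finite_choices]) (auto simp: choices_def I)
    hence "transition p a b I = (\<Sum>uv\<in>?K. ?q uv I * choice_weight p a b uv)"
      by (simp add: transition_def I sum_divide_distrib)
    hence "law t I * transition p a b I = (\<Sum>uv\<in>?K. law t I * ?q uv I * choice_weight p a b uv)"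
      by (simp only: sum_distrib_left mult.assoc)
    thus "(\<Sum>uv\<in>?K. ennreal (law t I * ?q uv I * choice_weight p a b uv)) =
        ennreal (law t I * transition p a b I)"
      by (simp add: law_nonneg choice_weight_nonneg p)
  qed
  finally show ?thesis .
qed

section \<open>Comparison of mirror images\<close>

text \<open>The sign \<open>s\<close> names a side of \<open>c / 2\<close>: right for 1, left for
  -1. The condition \<open>s * c \<le> 0\<close> puts the starting point 0 on that side, boundary
  included.\<close>

lemma law_reflect_le:
  assumes p: "0 < p" "p < 1" and A0: "A\<^sub>0 = {0}"
    and s: "s = 1 \<or> s = (-1 :: int)" and c: "s * c \<le> 0"
  shows "l \<le> r \<Longrightarrow> s * (l + r - c) \<ge> 0 \<Longrightarrow> law t (reflect c (l, r)) \<le> law t (l, r)"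
proof (induction t arbitrary: l r)
  case 0
  have "law 0 (u, v) = (if u = 0 \<and> v = 0 then 1 else 0)" for u v
  proof -
    have "{u..v} = {0} \<longleftrightarrow> u = 0 \<and> v = 0" by auto
    hence "A\<^sub>0 = {u..v} \<longleftrightarrow> u = 0 \<and> v = 0" unfolding A0 by metis
    hence "{\<omega> \<in> space M. \<zeta> 0 \<omega> = {u..v}} = (if u = 0 \<and> v = 0 then space M else {})"
      by (simp add: initial cong: conj_cong)
    thus ?thesis by (simp add: law_def prob_space)
  qed
  \<comment> \<open>The mirror image is \<open>{0}\<close> only if \<open>l = r = c\<close>. The
    side condition then reads \<open>s * c \<ge> 0\<close>, which forces \<open>c = 0\<close>, so
    the interval itself is \<open>{0}\<close> too.\<close>
  moreover have "l = 0 \<and> r = 0" if "c = r" "c = l"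
    using s 0 c that by auto
  ultimately show ?case by (cases "c = r \<and> c = l") (auto simp: reflect_def)
next
  case (Suc t)
  let ?G = "transition p l r"
  have "ennreal (law (Suc t) (reflect c (l, r))) =
      (\<integral>\<^sup>+I. ennreal (law t I * ?G (reflect c I)) \<partial>count_space intervals)"
  proof -
    have "reflect c (l, r) = (c - r, c - l)" by (simp add: reflect_def)
    thus ?thesis
      using law_Suc[OF p, of "c - r" "c - l" t] Suc.prems
      by (simp only: transition_reflect[OF p] diff_left_mono)
  qed
  also have "\<dots> \<le> (\<integral>\<^sup>+I. ennreal (law t I * ?G I) \<partial>count_space intervals)"
  proof (rule nn_integral_reflect_le)
    fix I assume I: "I \<in> intervals"
    \<comment> \<open>For sources on the chosen side, the induction hypothesis orders the law and
      \<open>transition_same_side\<close> orders the kernel in the same direction.\<close>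
    have *: "law t (reflect c (x, y)) \<le> law t (x, y) \<and> ?G (reflect c (x, y)) \<le> ?G (x, y)"
      if "x \<le> y" "s * (x + y - c) \<ge> 0" for x y
      using Suc.IH[OF that] transition_same_side[OF p s Suc.prems(2) that(2)]
        transition_reflect[OF p] by simp
    obtain x y where xy: "I = (x, y)" by (cases I)
    show "(law t I - law t (reflect c I)) * (?G I - ?G (reflect c I)) \<ge> 0"
    proof (cases "s * (x + y - c) \<ge> 0")
      case True
      with * [of x y] I show ?thesis by (auto simp: xy intervals_def)
    next
      case False
      \<comment> \<open>Now the mirror image lies on the chosen side, so both differences are
        nonpositive.\<close>
      hence "s * ((c - y) + (c - x) - c) \<ge> 0" using s by auto
      with * [of "c - y" "c - x"] I show ?thesis
        unfolding xy by (intro mult_nonpos_nonpos) (auto simp: intervals_def reflect_def)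
    qed
  qed (simp_all add: law_nonneg transition_nonneg p)
  also have "\<dots> = ennreal (law (Suc t) (l, r))"
    using law_Suc[OF p, of l r t] Suc.prems by simp
  finally show ?case by (simp add: law_nonneg)
qed

text \<open>The rearrangement inequality is used once more, with the indicator of covering
  \<open>x\<close> in place of the kernel.\<close>

lemma prob_mem_reflect_le:
  assumes p: "0 < p" "p < 1" and A0: "A\<^sub>0 = {0}"
    and s: "s = 1 \<or> s = (-1 :: int)" and c: "s * c \<le> 0" and x: "s * (2 * x - c) \<ge> 0"
  shows "\<P>(\<omega> in M. c - x \<in> \<zeta> t \<omega>) \<le> \<P>(\<omega> in M. x \<in> \<zeta> t \<omega>)"
proof -
  let ?G = "\<lambda>I. indicator {fst I..snd I} x :: real"
  have G: "indicator {fst I..snd I} (c - x) = ?G (reflect c I)" for I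
    by (auto simp: reflect_def indicator_def split: prod.split)
  have "emeasure M {\<omega> \<in> space M. c - x \<in> \<zeta> t \<omega>} =
      (\<integral>\<^sup>+I. ennreal (law t I * ?G (reflect c I)) \<partial>count_space intervals)"
    unfolding emeasure_mem_state G ..
  also have "\<dots> \<le> (\<integral>\<^sup>+I. ennreal (law t I * ?G I) \<partial>count_space intervals)"
  proof (rule nn_integral_reflect_le)
    fix I assume I: "I \<in> intervals"
    \<comment> \<open>As \<open>x\<close> and the centre of \<open>{l..r}\<close> are on the same
      side of \<open>c / 2\<close>, \<open>x\<close> is at least as close to the centre as
      \<open>c - x\<close> is. So an interval covering \<open>c - x\<close> also covers
      \<open>x\<close>.\<close>
    have *: "law t (reflect c (l, r)) \<le> law t (l, r) \<and> ?G (reflect c (l, r)) \<le> ?G (l, r)"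
      if "l \<le> r" "s * (l + r - c) \<ge> 0" for l r
      using law_reflect_le[OF p A0 s c that] that s x by (auto simp: reflect_def indicator_def)
    obtain l r where lr: "I = (l, r)" by (cases I)
    show "(law t I - law t (reflect c I)) * (?G I - ?G (reflect c I)) \<ge> 0"
    proof (cases "s * (l + r - c) \<ge> 0")
      case True
      with * [of l r] I show ?thesis by (auto simp: lr intervals_def)
    next
      case False
      hence "s * ((c - r) + (c - l) - c) \<ge> 0" using s by auto
      with * [of "c - r" "c - l"] I show ?thesis
        unfolding lr by (intro mult_nonpos_nonpos) (auto simp: intervals_def reflect_def)
    qed
  qed (simp_all add: law_nonneg)
  also have "\<dots> = emeasure M {\<omega> \<in> space M. x \<in> \<zeta> t \<omega>}"
    unfolding emeasure_mem_state ..
  finally show ?thesis by (simp add: emeasure_eq_measure)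
qed

end

theorem theorem1:
  fixes M :: "'a measure" and p :: real
    and \<zeta> \<xi> :: "nat \<Rightarrow> 'a \<Rightarrow> int set"
    and NL NR :: "nat \<Rightarrow> 'a \<Rightarrow> nat"
    and f :: "nat \<Rightarrow> int \<Rightarrow> real"
  defines "f \<equiv> (\<lambda>t x. \<P>(\<omega> in M. x \<in> \<zeta> t \<omega>))"
  assumes "0 < p" and "p < 1"
    and "standard_rfi_process M p {0} \<zeta> \<xi> NL NR"
  shows "\<forall>t. (\<forall>x. f t x = f t (- x)) \<and> (\<forall>x\<ge>0. f t x \<ge> f t (x + 1))"
proof -
  interpret standard_rfi_process M p "{0}" \<zeta> \<xi> NL NR by fact
  note mirror = prob_mem_reflect_le[OF assms(2,3) refl, folded f_def]
  \<comment> \<open>The side is chosen to contain \<open>x\<close>: \<open>s = 1\<close> for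
    \<open>x \<ge> 0\<close>, \<open>s = -1\<close> otherwise. As this holds for every
    \<open>x\<close>, replacing \<open>x\<close> by \<open>- x\<close> gives equality.\<close>
  have le: "f t (- x) \<le> f t x" for t x
    using mirror[of 1 0 x t] mirror[of "-1" 0 x t] unfolding f_def by (cases "x \<ge> 0") auto
  have even: "f t x = f t (- x)" for t x
    using le[of t x] le[of t "- x"] by simp
  have "f t (x + 1) \<le> f t x" if "x \<ge> 0" for t x
    using mirror[of 1 "-1" x t] that even[of t "x + 1"] unfolding f_def by (simp add: algebra_simps)
  with even show ?thesis by blast
qed

end
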